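(* Let $A:S^1\to\mathbb{R}$ be a Lipschitz continuous function having a unique maximizing probability, with $m(A)=0$, let $u\in\mathcal{C}$ be its unique calibrated subaction, and let $\mathcal{G}=\mathcal{G}_A:\mathcal{C}\to\mathcal{C}$ be the associated operator. For any $\varepsilon>0$ there exists a function $f\in\mathcal{C}$, $f\neq u$, which is $\varepsilon$-close to $u$ (i.e. $|f-u|<\varepsilon$) and such that $|\mathcal{G}(f)-u|=\frac12|f-u|$.
   Context: $S^1=\mathbb{R}/\mathbb{Z}$ and $T(x)=2x\pmod 1$ is the doubling map. $m(A):=\sup_{\rho\ T\text{-invariant}}\int A\,d\rho$ over $T$-invariant probabilities; a maximizing probability is one attaining this supremum. A calibrated subaction for $A$ is a continuous $u:S^1\to\mathbb{R}$ with $u(x)=\max_{T(y)=x}[A(y)+u(y)-m(A)]$ for all $x\in S^1$; it is known that when the maximizing probability is unique, the calibrated subaction exists and is unique up to an additive constant, i.e. unique in $\mathcal{C}$, and it is the unique fixed point of $\mathcal{G}$. $C^0$ is the space of continuous functions $S^1\to\mathbb{R}$ with $|f|_0=\sup|f|$, and $\mathcal{C}=C^0/\mathbb{R}$ is its quotient by the constants; in each class the representative with supremum $0$ is chosen. $\mathcal{C}$ carries the quotient norm $|f|=\inf_{\alpha\in\mathbb{R}}|f+\alpha|_0=\frac{\max f-\min f}{2}$. The operator $\mathcal{G}_A:\mathcal{C}\to\mathcal{C}$ is $$\mathcal{G}_A(f)(x)=\frac{\max_{T(y)=x}[A(y)+f(y)]+f(x)}{2}-c_f,\qquad c_f=\sup_{s\in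 S^1}\frac{\max_{T(r)=s}[A(r)+f(r)]+f(s)}{2}.$$ *)

theory Defs
  imports "HOL-Probability.Probability"
begin

section \<open>The circle and the doubling map\<close>

quotient_type circle = real / "\<lambda>x y. x - y \<in> \<int>"
proof (rule equivpI)
  show "reflp (\<lambda>x y::real. x - y \<in> \<int>)" by (simp add: reflp_def)
  show "symp (\<lambda>x y::real. x - y \<in> \<int>)"
    by (auto simp: symp_def) (metis Ints_minus minus_diff_eq)
  show "transp (\<lambda>x y::real. x - y \<in> \<int>)"
    by (auto simp: transp_def) (metis Ints_add diff_add_cancel add_diff_eq)
qed

lemma circle_cases [cases type: circle]:
  obtains t where "x = abs_circle t"
  by (metis Quotient_abs_rep Quotient_circle)

lemma infdist_Ints_attained:
  obtains k :: real where "k \<in> \<int>" "infdist x \<int> = dist x k"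
  using infdist_attains_inf[of "\<int> :: real set" x] Ints_0 closed_Ints by blast

lemma infdist_Ints_cong:
  fixes a b :: real
  assumes "a - b \<in> \<int>"
  shows "infdist a \<int> = infdist b \<int>"
proof -
  have le: "infdist a \<int> \<le> infdist b \<int>" if ab: "a - b \<in> \<int>" for a b :: real
  proof -
    obtain k :: real where k: "k \<in> \<int>" "infdist b \<int> = dist b k"
      by (rule infdist_Ints_attained)
    have "k + (a - b) \<in> \<int>" using k ab by (intro Ints_add)
    then have "infdist a \<int> \<le> dist a (k + (a - b))" by (rule infdist_le)
    also have "\<dots> = dist b k" by (simp add: dist_real_def)
    finally show ?thesis using k by simp
  qed
  have "b - a \<in> \<int>" using assms by (metis Ints_minus minus_diff_eq)
  with assms show ?thesis by (intro antisym le)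
qed

instantiation circle :: metric_space
begin

text \<open>The distance inherited from \<open>\<real>\<close>: the distance of \<open>x - y\<close> to the nearest integer.\<close>

lift_definition dist_circle :: "circle \<Rightarrow> circle \<Rightarrow> real"
  is "\<lambda>x y. infdist (x - y) \<int>"
proof -
  fix x x' y y' :: real
  assume "x - x' \<in> \<int>" "y - y' \<in> \<int>"
  then have "(x - x') - (y - y') \<in> \<int>" by (rule Ints_diff)
  then show "infdist (x - y) \<int> = infdist (x' - y') \<int>"
    by (intro infdist_Ints_cong) (simp add: algebra_simps)
qed

definition uniformity_circle :: "(circle \<times> circle) filter"
  where "uniformity_circle = (INF e\<in>{0 <..}. principal {(x, y). dist x y < e})"

definition open_circle :: "circle set \<Rightarrow> bool"
  where "open_circle U = (\<forall>x\<in>U. eventually (\<lambda>(x', y). x' = x \<longrightarrow> y \<in> U) uniformity)"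

instance
proof
  fix x y z :: circle
  show "dist x y = 0 \<longleftrightarrow> x = y"
  proof transfer
    fix x y :: real
    show "infdist (x - y) \<int> = 0 \<longleftrightarrow> x - y \<in> \<int>"
      using in_closed_iff_infdist_zero[of "\<int> :: real set" "x - y"] Ints_0 by auto
  qed
  show "dist x y \<le> dist x z + dist y z"
  proof transfer
    fix x y z :: real
    obtain k where k: "k \<in> \<int>" "infdist (x - z) \<int> = dist (x - z) k"
      by (rule infdist_Ints_attained)
    obtain l where l: "l \<in> \<int>" "infdist (y - z) \<int> = dist (y - z) l"
      by (rule infdist_Ints_attained)
    have "infdist (x - y) \<int> \<le> dist (x - y) (k - l)"
      using k l by (intro infdist_le Ints_diff)
    also have "\<dots> \<le> dist (x - z) k + dist (y - z) l"
      unfolding dist_real_def by linarith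
    finally show "infdist (x - y) \<int> \<le> infdist (x - z) \<int> + infdist (y - z) \<int>"
      using k l by simp
  qed
qed (simp_all add: uniformity_circle_def open_circle_def)

end

lift_definition doubling :: "circle \<Rightarrow> circle" is "\<lambda>x. 2 * x"
proof -
  fix x y :: real
  assume "x - y \<in> \<int>"
  then have "2 * (x - y) \<in> \<int>" by (intro Ints_mult) auto
  then show "2 * x - 2 * y \<in> \<int>" by (simp add: algebra_simps)
qed

lemma doubling_preimage:
  "{y. doubling y = abs_circle t} = {abs_circle (t / 2), abs_circle (t / 2 + 1 / 2)}"
proof (intro set_eqI iffI)
  fix y assume "y \<in> {y. doubling y = abs_circle t}"
  moreover obtain s where s: "y = abs_circle s" by (cases y)
  ultimately have "2 * s - t \<in> \<int>" by (simp add: doubling.abs_eq circle.abs_eq_iff)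
  then obtain k where k: "2 * s - t = of_int k" by (auto elim: Ints_cases)
  show "y \<in> {abs_circle (t / 2), abs_circle (t / 2 + 1 / 2)}"
  proof (cases "even k")
    case True
    then obtain l where "k = 2 * l" by blast
    with k have "s - t / 2 = of_int l" by simp
    then show ?thesis by (simp add: s circle.abs_eq_iff)
  next
    case False
    then obtain l where "k = 2 * l + 1" by (blast elim: oddE)
    with k have "s - (t / 2 + 1 / 2) = of_int l" by (simp add: field_simps)
    then show ?thesis by (simp add: s circle.abs_eq_iff)
  qed
qed (auto simp: doubling.abs_eq circle.abs_eq_iff)

lemma finite_doubling_preimage: "finite {y. doubling y = x}"
  by (cases x) (simp add: doubling_preimage)

lemma doubling_preimage_nonempty: "{y. doubling y = x} \<noteq> {}"
  by (cases x) (simp add: doubling_preimage)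

section \<open>Invariant and maximizing probabilities\<close>

definition invariant_prob :: "circle measure \<Rightarrow> bool" where
  "invariant_prob \<rho> \<longleftrightarrow>
     prob_space \<rho> \<and> sets \<rho> = sets borel \<and> distr \<rho> borel doubling = \<rho>"

definition max_mean :: "(circle \<Rightarrow> real) \<Rightarrow> real" where
  "max_mean A = (SUP \<rho>\<in>{\<rho>. invariant_prob \<rho>}. integral\<^sup>L \<rho> A)"

definition maximizing_prob :: "(circle \<Rightarrow> real) \<Rightarrow> circle measure \<Rightarrow> bool" where
  "maximizing_prob A \<rho> \<longleftrightarrow> invariant_prob \<rho> \<and> integral\<^sup>L \<rho> A = max_mean A"

section \<open>Continuous functions modulo constants\<close>

text \<open>A class in \<open>C\<^sup>0/\<real>\<close> is represented by its unique member with supremum \<open>0\<close>.\<close>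

definition C0_mod_const :: "(circle \<Rightarrow> real) set" where
  "C0_mod_const = {f. continuous_on UNIV f \<and> (SUP x. f x) = 0}"

definition sup_norm :: "(circle \<Rightarrow> real) \<Rightarrow> real" where
  "sup_norm f = (SUP x. \<bar>f x\<bar>)"

definition quotient_norm :: "(circle \<Rightarrow> real) \<Rightarrow> real" where
  "quotient_norm f = (INF \<alpha>::real. sup_norm (\<lambda>x. f x + \<alpha>))"

section \<open>Calibrated subactions and the operator\<close>

definition max_preimage :: "(circle \<Rightarrow> real) \<Rightarrow> circle \<Rightarrow> real" where
  "max_preimage g x = Max (g ` {y. doubling y = x})"

definition calibrated_subaction :: "(circle \<Rightarrow> real) \<Rightarrow> (circle \<Rightarrow> real) \<Rightarrow> bool" where
  "calibrated_subaction A u \<longleftrightarrow>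
     continuous_on UNIV u \<and> (\<forall>x. u x = max_preimage (\<lambda>y. A y + u y - max_mean A) x)"

definition G_const :: "(circle \<Rightarrow> real) \<Rightarrow> (circle \<Rightarrow> real) \<Rightarrow> real" where
  "G_const A f = (SUP s. (max_preimage (\<lambda>r. A r + f r) s + f s) / 2)"

definition G_op :: "(circle \<Rightarrow> real) \<Rightarrow> (circle \<Rightarrow> real) \<Rightarrow> circle \<Rightarrow> real" where
  "G_op A f x = (max_preimage (\<lambda>y. A y + f y) x + f x) / 2 - G_const A f"

subsection \<open>The representatives and the operator are well defined\<close>

lemma dist_abs_circle_le: "dist (abs_circle s) (abs_circle t) \<le> \<bar>s - t\<bar>"
  using infdist_le[of "0::real" "\<int>" "s - t"] by (simp add: dist_circle.abs_eq)

lemma dist_circle_attained: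
  obtains s where "x = abs_circle s" "\<bar>s - t\<bar> = dist x (abs_circle t)"
proof -
  obtain r where r: "x = abs_circle r" by (cases x)
  obtain k where k: "k \<in> \<int>" "infdist (r - t) \<int> = dist (r - t) k"
    by (rule infdist_Ints_attained)
  have "x = abs_circle (r - k)" using k by (simp add: r circle.abs_eq_iff)
  moreover have "\<bar>(r - k) - t\<bar> = dist x (abs_circle t)"
    using k by (simp add: r dist_circle.abs_eq dist_real_def algebra_simps)
  ultimately show thesis by (rule that)
qed

lemma continuous_on_abs_circle: "continuous_on UNIV abs_circle"
  unfolding continuous_on_iff
  by (metis dist_abs_circle_le dist_real_def le_less_trans)

lemma compact_UNIV_circle: "compact (UNIV :: circle set)"
proof -
  have "abs_circle ` {0..1} = UNIV"
  proof (intro set_eqI iffI UNIV_I)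
    fix x :: circle
    obtain t where t: "x = abs_circle t" by (cases x)
    have "t - frac t \<in> \<int>" by (simp add: frac_def)
    then have "x = abs_circle (frac t)" by (simp add: t circle.abs_eq_iff)
    moreover have "frac t \<in> {0..1}" by (simp add: frac_lt_1 less_imp_le)
    ultimately show "x \<in> abs_circle ` {0..1}" by blast
  qed
  moreover have "compact (abs_circle ` {0..1})"
    by (intro compact_continuous_image continuous_on_subset[OF continuous_on_abs_circle]) auto
  ultimately show ?thesis by simp
qed

lemma continuous_on_circle_lift:
  assumes "continuous_on UNIV (\<lambda>t. f (abs_circle t))"
  shows "continuous_on UNIV (f :: circle \<Rightarrow> real)"
  unfolding continuous_on_iff
proof (intro ballI allI impI)
  fix x :: circle and e :: real
  assume e: "0 < e"
  obtain t where t: "x = abs_circle t" by (cases x)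
  obtain d where d: "d > 0" "\<And>s. dist s t < d \<Longrightarrow> dist (f (abs_circle s)) (f (abs_circle t)) < e"
    using assms e unfolding continuous_on_iff by blast
  have "dist (f y) (f x) < e" if y: "dist y x < d" for y
  proof -
    obtain s where "y = abs_circle s" "\<bar>s - t\<bar> = dist y (abs_circle t)"
      by (rule dist_circle_attained)
    then show ?thesis using d(2)[of s] y t by (simp add: dist_real_def)
  qed
  with d show "\<exists>d>0. \<forall>x'\<in>UNIV. dist x' x < d \<longrightarrow> dist (f x') (f x) < e" by blast
qed

lemma max_preimage_abs_circle:
  "max_preimage g (abs_circle t) = max (g (abs_circle (t / 2))) (g (abs_circle (t / 2 + 1 / 2)))"
  by (simp add: max_preimage_def doubling_preimage)

lemma continuous_on_max_preimage:
  assumes "continuous_on UNIV g"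
  shows "continuous_on UNIV (max_preimage g)"
proof (rule continuous_on_circle_lift)
  have *: "continuous_on UNIV (\<lambda>t. g (abs_circle (h t)))" if "continuous_on UNIV h" for h :: "real \<Rightarrow> real"
    by (rule continuous_on_compose2[OF assms continuous_on_compose2[OF continuous_on_abs_circle that]]) auto
  show "continuous_on UNIV (\<lambda>t. max_preimage g (abs_circle t))"
    unfolding max_preimage_abs_circle by (intro continuous_on_max * continuous_intros) auto
qed

lemma bdd_above_circle:
  assumes "continuous_on UNIV (f :: circle \<Rightarrow> real)"
  shows "bdd_above (range f)"
  using compact_continuous_image[OF assms compact_UNIV_circle]
  by (simp add: bounded_imp_bdd_above compact_imp_bounded)

lemma SUP_add_const_circle:
  assumes "continuous_on UNIV (f :: circle \<Rightarrow> real)"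
  shows "(SUP x. f x + c) = (SUP x. f x) + c"
proof (rule cSup_eq_non_empty)
  fix z assume "z \<in> range (\<lambda>x. f x + c)"
  then show "z \<le> (SUP x. f x) + c"
    using cSUP_upper[OF UNIV_I bdd_above_circle[OF assms]] by auto
next
  fix y assume "\<And>z. z \<in> range (\<lambda>x. f x + c) \<Longrightarrow> z \<le> y"
  then have "f x \<le> y - c" for x by (simp add: le_diff_eq)
  then have "(SUP x. f x) \<le> y - c" by (intro cSUP_least) auto
  then show "(SUP x. f x) + c \<le> y" by simp
qed simp

lemma ex1_representative:
  assumes "continuous_on UNIV f"
  shows "\<exists>!c. (\<lambda>x. f x + c) \<in> C0_mod_const"
proof
  show "(\<lambda>x. f x + - (SUP x. f x)) \<in> C0_mod_const"
    unfolding C0_mod_const_def mem_Collect_eq SUP_add_const_circle[OF assms]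
    by (auto intro!: continuous_intros assms)
next
  fix c assume "(\<lambda>x. f x + c) \<in> C0_mod_const"
  then show "c = - (SUP x. f x)"
    unfolding C0_mod_const_def mem_Collect_eq SUP_add_const_circle[OF assms] by simp
qed

lemma G_op_in_C0_mod_const:
  assumes "continuous_on UNIV A" "f \<in> C0_mod_const"
  shows "G_op A f \<in> C0_mod_const"
proof -
  have f: "continuous_on UNIV f" using assms by (simp add: C0_mod_const_def)
  have c: "continuous_on UNIV (\<lambda>x. (max_preimage (\<lambda>y. A y + f y) x + f x) / 2)"
    by (intro continuous_intros continuous_on_max_preimage assms f) auto
  show ?thesis
    using SUP_add_const_circle[OF c, of "- G_const A f"] c
    unfolding C0_mod_const_def mem_Collect_eq G_op_def
    by (auto simp: G_const_def[symmetric] intro!: continuous_intros)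
qed

end

theory Submission
  imports Defs
begin

text \<open>
  Write \<open>T\<close> for the doubling map and \<open>f = u + g\<close> up to a constant.  Call \<open>y\<close> optimal if
  \<open>A y + u y = u (T y)\<close>; because \<open>u\<close> is calibrated and \<open>m(A) = 0\<close>, no \<open>y\<close> gives a larger value
  than \<open>u (T y)\<close>, and every point has an optimal preimage.  Hence a perturbation \<open>g \<le> 0\<close> that
  vanishes at one optimal preimage of every point does not change the maximum over preimages:
  it stays equal to \<open>u\<close>.  Averaging with \<open>f\<close> then gives \<open>G(f) = u + g/2\<close> up to a constant, so
  the distance to \<open>u\<close> is multiplied by exactly \<open>1/2\<close>
  (\<open>max_preimage_perturbed\<close>, \<open>quotient_norm_affine\<close>).

  It remains to find such a \<open>g\<close> that is small and not constant.  It is a negative tent supported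
  in a small ball, and the ball must leave an optimal preimage of every point outside.  The optimal
  points form a closed set, and \<open>ball_avoided_by_preimages\<close> finds such a ball: away from the
  optimal points if there are others, and anywhere if all points are optimal.
\<close>

lemma abs_le_sup_norm:
  assumes "continuous_on UNIV f"
  shows "\<bar>f x\<bar> \<le> sup_norm f"
  unfolding sup_norm_def
  by (rule cSUP_upper[OF UNIV_I bdd_above_circle]) (intro continuous_intros assms)

lemma sup_norm_leI:
  assumes "\<And>x. \<bar>f x\<bar> \<le> b"
  shows "sup_norm f \<le> b"
  unfolding sup_norm_def by (rule cSUP_least) (auto intro: assms)

lemma sup_norm_scale:
  assumes f: "continuous_on UNIV f" and a: "0 < a"
  shows "sup_norm (\<lambda>x. a * f x) = a * sup_norm f"
proof (rule antisym)
  show "sup_norm (\<lambda>x. a * f x) \<le> a * sup_norm f"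
    using abs_le_sup_norm[OF f] a by (intro sup_norm_leI) (simp add: abs_mult)
  have "sup_norm f \<le> sup_norm (\<lambda>x. a * f x) / a"
  proof (rule sup_norm_leI)
    fix x
    have "\<bar>a * f x\<bar> \<le> sup_norm (\<lambda>x. a * f x)"
      by (rule abs_le_sup_norm) (intro continuous_intros f)
    then show "\<bar>f x\<bar> \<le> sup_norm (\<lambda>x. a * f x) / a"
      using a by (simp add: abs_mult field_simps)
  qed
  then show "a * sup_norm f \<le> sup_norm (\<lambda>x. a * f x)"
    using a by (simp add: field_simps)
qed

lemma quotient_norm_le_shift:
  assumes "continuous_on UNIV f"
  shows "quotient_norm f \<le> sup_norm (\<lambda>x. f x + \<alpha>)"
  unfolding quotient_norm_def
proof (rule cINF_lower)
  have "0 \<le> sup_norm (\<lambda>x. f x + \<beta>)" for \<beta>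
    by (rule order_trans[OF abs_ge_zero abs_le_sup_norm]) (intro continuous_intros assms)
  then show "bdd_below (range (\<lambda>\<beta>. sup_norm (\<lambda>x. f x + \<beta>)))"
    by (intro bdd_belowI[of _ 0]) auto
qed simp

lemma quotient_norm_affine:
  assumes f: "continuous_on UNIV f" and a: "0 < a"
  shows "quotient_norm (\<lambda>x. a * f x + c) = a * quotient_norm f"
proof -
  have shift: "sup_norm (\<lambda>x. a * f x + c + \<alpha>) = a * sup_norm (\<lambda>x. f x + (c + \<alpha>) / a)" for \<alpha>
  proof -
    have "sup_norm (\<lambda>x. a * (f x + (c + \<alpha>) / a)) = a * sup_norm (\<lambda>x. f x + (c + \<alpha>) / a)"
      by (rule sup_norm_scale[OF _ a]) (intro continuous_intros f)
    moreover have "a * (f x + (c + \<alpha>) / a) = a * f x + c + \<alpha>" for x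
      using a by (simp add: field_simps)
    ultimately show ?thesis by simp
  qed
  show ?thesis
  proof (rule antisym)
    have "quotient_norm (\<lambda>x. a * f x + c) / a \<le> quotient_norm f"
      unfolding quotient_norm_def[of f]
    proof (rule cINF_greatest)
      fix \<beta> :: real
      have "quotient_norm (\<lambda>x. a * f x + c) \<le> sup_norm (\<lambda>x. a * f x + c + (a * \<beta> - c))"
        by (rule quotient_norm_le_shift) (intro continuous_intros f)
      then show "quotient_norm (\<lambda>x. a * f x + c) / a \<le> sup_norm (\<lambda>x. f x + \<beta>)"
        using a unfolding shift by (simp add: field_simps)
    qed simp
    then show "quotient_norm (\<lambda>x. a * f x + c) \<le> a * quotient_norm f"
      using a by (simp add: field_simps)
    show "a * quotient_norm f \<le> quotient_norm (\<lambda>x. a * f x + c)"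
      unfolding quotient_norm_def[of "\<lambda>x. a * f x + c"]
      by (rule cINF_greatest) (use quotient_norm_le_shift[OF f] a in \<open>simp_all add: shift\<close>)
  qed
qed

lemma continuous_on_doubling: "continuous_on UNIV doubling"
proof -
  have "dist (doubling x) (doubling y) \<le> 2 * dist x y" for x y
  proof -
    obtain t where t: "y = abs_circle t" by (cases y)
    obtain s where "x = abs_circle s" "\<bar>s - t\<bar> = dist x (abs_circle t)"
      by (rule dist_circle_attained)
    then show ?thesis
      using dist_abs_circle_le[of "2 * s" "2 * t"] by (simp add: t doubling.abs_eq)
  qed
  then have "2-lipschitz_on UNIV doubling" by (intro lipschitz_onI) auto
  then show ?thesis by (rule lipschitz_on_continuous_on)
qed

lemma dist_antipode: "dist (abs_circle t) (abs_circle (t + 1 / 2)) \<ge> 1 / 2"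
proof -
  obtain k :: real where k: "k \<in> \<int>" "infdist (- (1 / 2) :: real) \<int> = dist (- (1 / 2)) k"
    by (rule infdist_Ints_attained)
  from k(1) obtain i :: int where i: "k = of_int i" by (auto elim: Ints_cases)
  have "i \<ge> 0 \<or> i \<le> - 1" by linarith
  then have "dist (- (1 / 2)) k \<ge> 1 / 2" unfolding i dist_real_def by linarith
  then show ?thesis using k by (simp add: dist_circle.abs_eq)
qed

text \<open>
  If \<open>B\<close> misses a point, it misses a ball around it, and every preimage taken in \<open>B\<close> lies outside
  that ball.  If \<open>B\<close> is the whole circle, both preimages of a point are available, and the
  triangle inequality keeps one of two antipodal points at distance at least \<open>1/4\<close> from the centre.
\<close>

lemma ball_avoided_by_preimages:
  assumes "closed B" and meets_fibres: "\<And>x. \<exists>y\<in>B. doubling y = x" and "0 < \<epsilon>"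
  obtains c r where "0 < r" "r < \<epsilon>" "\<And>x. \<exists>y\<in>B. doubling y = x \<and> r \<le> dist c y"
proof (cases "B = UNIV")
  case True
  define r where "r = min (\<epsilon> / 2) (1 / 4)"
  have "\<exists>y\<in>B. doubling y = x \<and> r \<le> dist (abs_circle 0) y" for x
  proof -
    obtain t where t: "x = abs_circle t" by (cases x)
    let ?y = "abs_circle (t / 2)" and ?z = "abs_circle (t / 2 + 1 / 2)"
    have "1 / 2 \<le> dist (abs_circle 0) ?y + dist (abs_circle 0) ?z"
      using dist_antipode[of "t / 2"] dist_triangle3[of ?y ?z "abs_circle 0"] by linarith
    then have "r \<le> dist (abs_circle 0) ?y \<or> r \<le> dist (abs_circle 0) ?z"
      unfolding r_def by linarith
    moreover have "doubling ?y = x" "doubling ?z = x"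
      using doubling_preimage[of t] by (auto simp: t)
    ultimately show ?thesis using True by blast
  qed
  then show thesis using \<open>0 < \<epsilon>\<close> by (intro that[of r]) (auto simp: r_def)
next
  case False
  then obtain c where "c \<in> - B" by blast
  moreover have "open (- B)" using \<open>closed B\<close> by (simp add: open_Compl)
  ultimately obtain e where e: "e > 0" "ball c e \<subseteq> - B"
    by (meson open_contains_ball)
  define r where "r = min e (\<epsilon> / 2)"
  have "r \<le> dist c y" if "y \<in> B" for y
  proof -
    have "y \<notin> ball c e" using e(2) that by blast
    then show ?thesis by (simp add: r_def)
  qed
  then have "\<exists>y\<in>B. doubling y = x \<and> r \<le> dist c y" for x using meets_fibres by blast
  with e(1) \<open>0 < \<epsilon>\<close> show thesis by (intro that[of r c]) (simp_all add: r_def)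
qed

text \<open>
  The perturbation \<open>g\<close> can only lower the values over the preimages of \<open>x\<close>, and one preimage
  where the maximum was attained keeps its value.
\<close>

lemma max_preimage_perturbed:
  assumes calibrated: "\<And>x. u x = max_preimage (\<lambda>y. A y + u y) x"
    and "\<And>y. g y \<le> 0"
    and vanish: "\<And>x. \<exists>y. doubling y = x \<and> A y + u y = u x \<and> g y = 0"
  shows "max_preimage (\<lambda>y. A y + (u y + g y + k)) x = u x + k"
  unfolding max_preimage_def
proof (rule Max_eqI)
  show "finite ((\<lambda>y. A y + (u y + g y + k)) ` {y. doubling y = x})"
    by (intro finite_imageI finite_doubling_preimage)
  show "u x + k \<in> (\<lambda>y. A y + (u y + g y + k)) ` {y. doubling y = x}"
  proof -
    obtain y where "doubling y = x" "A y + u y = u x" "g y = 0" using vanish by blast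
    then show ?thesis by (intro image_eqI[of _ _ y]) auto
  qed
next
  fix v assume "v \<in> (\<lambda>y. A y + (u y + g y + k)) ` {y. doubling y = x}"
  then obtain y where y: "doubling y = x" "v = A y + (u y + g y + k)" by blast
  have "A y + u y \<le> max_preimage (\<lambda>y. A y + u y) x"
    unfolding max_preimage_def
    by (rule Max_ge) (use y in \<open>auto intro: finite_doubling_preimage\<close>)
  then have "A y + u y \<le> u x" by (simp flip: calibrated)
  with y \<open>g y \<le> 0\<close> show "v \<le> u x + k" by linarith
qed

theorem corollary29:
  fixes A u :: "circle \<Rightarrow> real" and \<epsilon> :: real
  assumes "\<exists>L. L-lipschitz_on UNIV A"
    and "\<exists>!\<rho>. maximizing_prob A \<rho>"
    and "max_mean A = 0"
    and "u \<in> C0_mod_const" and "calibrated_subaction A u"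
    and "\<epsilon> > 0"
  shows "\<exists>f\<in>C0_mod_const. f \<noteq> u \<and>
           quotient_norm (\<lambda>x. f x - u x) < \<epsilon> \<and>
           quotient_norm (\<lambda>x. G_op A f x - u x) = (1 / 2) * quotient_norm (\<lambda>x. f x - u x)"
proof -
  have A: "continuous_on UNIV A"
    using assms(1) by (auto intro: lipschitz_on_continuous_on)
  have u: "continuous_on UNIV u"
    using assms(4) by (simp add: C0_mod_const_def)
  have calibrated: "u x = max_preimage (\<lambda>y. A y + u y) x" for x
    using assms(5) unfolding calibrated_subaction_def assms(3) diff_zero by blast

  define B where "B = {y. A y + u y = u (doubling y)}"
  have "continuous_on UNIV (\<lambda>y. u (doubling y))"
    by (rule continuous_on_compose2[OF u continuous_on_doubling]) simp
  then have "closed B"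
    unfolding B_def by (intro closed_Collect_eq continuous_on_add A u)
  have "\<exists>y\<in>B. doubling y = x" for x
  proof -
    have "max_preimage (\<lambda>y. A y + u y) x \<in> (\<lambda>y. A y + u y) ` {y. doubling y = x}"
      unfolding max_preimage_def
      by (rule Max_in) (use finite_doubling_preimage doubling_preimage_nonempty in blast)+
    then show ?thesis unfolding calibrated[symmetric] B_def by force
  qed
  with \<open>closed B\<close> obtain c r where r: "0 < r" "r < \<epsilon>"
    and avoid: "\<And>x. \<exists>y\<in>B. doubling y = x \<and> r \<le> dist c y"
    using \<open>\<epsilon> > 0\<close> by (rule ball_avoided_by_preimages) blast

  \<comment> \<open>The tent has depth \<open>r\<close> as well as radius \<open>r\<close>, which makes it smaller than \<open>\<epsilon>\<close>.\<close>
  define g where "g y = min 0 (dist c y - r)" for y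
  have g: "continuous_on UNIV g"
    unfolding g_def by (intro continuous_intros)
  have "g y \<le> 0" for y by (simp add: g_def)
  have vanish: "\<exists>y. doubling y = x \<and> A y + u y = u x \<and> g y = 0" for x
    using avoid[of x] by (auto simp: B_def g_def)

  have ug: "continuous_on UNIV (\<lambda>x. u x + g x)"
    by (intro continuous_intros u g)
  obtain k where k: "(\<lambda>x. u x + g x + k) \<in> C0_mod_const"
    using ex1_representative[OF ug] by blast
  define f where "f x = u x + g x + k" for x
  have "f \<noteq> u"
  proof
    assume "f = u"
    have const: "g x + k = 0" for x
      using fun_cong[OF \<open>f = u\<close>, of x] by (simp add: f_def)
    obtain y where "g y = 0" using vanish by blast
    then show False
      using const[of y] const[of c] r(1) by (simp add: g_def)
  qed
  moreover have "f \<in> C0_mod_const"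
    using k by (simp add: f_def[abs_def])
  moreover have diff: "quotient_norm (\<lambda>x. f x - u x) = quotient_norm g"
    using quotient_norm_affine[OF g, of 1 k] by (simp add: f_def)
  moreover have "quotient_norm g < \<epsilon>"
  proof -
    have "quotient_norm g \<le> sup_norm g"
      using quotient_norm_le_shift[OF g, of 0] by simp
    also have "\<dots> \<le> r"
      by (rule sup_norm_leI) (use r(1) in \<open>simp add: g_def min_def\<close>)
    finally show ?thesis using r(2) by simp
  qed
  moreover have "quotient_norm (\<lambda>x. G_op A f x - u x) = 1 / 2 * quotient_norm g"
  proof -
    have "max_preimage (\<lambda>y. A y + f y) x = u x + k" for x
      unfolding f_def using calibrated \<open>\<And>y. g y \<le> 0\<close> vanish by (rule max_preimage_perturbed[of u A g])
    then have "G_op A f x - u x = 1 / 2 * g x + (k - G_const A f)" for x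
      by (simp add: G_op_def f_def field_simps)
    then show ?thesis using quotient_norm_affine[OF g, of "1 / 2"] by simp
  qed
  ultimately show ?thesis by metis
qed

end
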